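(* Let $n\ge 1$ be an integer and $0<s<1$. For any $p<0$, the equation $$(\partial_t-\Delta)^s u(x,t)=x_1u^p(x,t)\quad\text{in } \mathbb{R}^n\times\mathbb{R},$$ where $x=(x_1,\dots,x_n)$, possesses no positive bounded classical solutions.
   Context: For $0<s<1$ the fully fractional heat (master) operator is $$(\partial_t-\Delta)^s u(x,t):=C_{n,s}\int_{-\infty}^{t}\int_{\mathbb{R}^n}\frac{u(x,t)-u(y,\tau)}{(t-\tau)^{\frac n2+1+s}}\,e^{-\frac{|x-y|^2}{4(t-\tau)}}\,dy\,d\tau,\qquad C_{n,s}=\frac{1}{(4\pi)^{n/2}|\Gamma(-s)|},$$ where the integral in $y$ is in the sense of Cauchy principal value. $\mathcal{L}(\mathbb{R}^n\times\mathbb{R})$ is the set of $u\in L^1_{\mathrm{loc}}(\mathbb{R}^n\times\mathbb{R})$ such that $\int_{-\infty}^t\int_{\mathbb{R}^n}\frac{|u(x,\tau)|e^{-|x|^2/(4(t-\tau))}}{1+(t-\tau)^{\frac n2+1+s}}\,dx\,d\tau<\infty$ for every $t\in\mathbb{R}$. Parabolic Hölder spaces $C^{2\alpha,\alpha}_{x,t}(\mathbb{R}^n\times\mathbb{R})$: (i) for $0<\alpha\le\frac12$, $u$ belongs to it if there is $C>0$ with $|u(x,t)-u(y,\tau)|\le C(|x-y|+|t-\tau|^{1/2})^{2\alpha}$ for all $x,y\in\mathbb{R}^n$, $t,\tau\in\mathbb{R}$; (ii) for $\frac12<\alpha\le1$, if $u$ is $\alpha$-Hölder continuous in $t$ uniformly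 in $x$, and $\nabla_x u$ is $(2\alpha-1)$-Hölder continuous in $x$ uniformly in $t$ and $(\alpha-\frac12)$-Hölder continuous in $t$ uniformly in $x$; (iii) for $\alpha>1$, if $\partial_tu, D_x^2u\in C^{2\alpha-2,\alpha-1}_{x,t}(\mathbb{R}^n\times\mathbb{R})$. The local space $C^{2\alpha,\alpha}_{x,t,\mathrm{loc}}$ is defined analogously, with the conditions required on bounded subsets of $\mathbb{R}^n\times\mathbb{R}$. The condition "$u\in C^{2s+\epsilon,s+\epsilon}_{x,t,\mathrm{loc}}(\mathbb{R}^n\times\mathbb{R})$ for some $\epsilon>0$" means $u\in C^{2\alpha,\alpha}_{x,t,\mathrm{loc}}(\mathbb{R}^n\times\mathbb{R})$ for some $\alpha>s$. A classical (entire) solution is a function $u\in C^{2s+\epsilon,s+\epsilon}_{x,t,\mathrm{loc}}(\mathbb{R}^n\times\mathbb{R})\cap\mathcal{L}(\mathbb{R}^n\times\mathbb{R})$ for some $\epsilon>0$ satisfying the equation at every point of $\mathbb{R}^n\times\mathbb{R}$. Positive means $u>0$ everywhere; bounded means $\sup_{\mathbb{R}^n\times\mathbb{R}}u<\infty$. *)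

theory Defs
  imports "HOL-Analysis.Analysis"
begin

text \<open>
  Functions on space-time are curried, \<open>u x t\<close> with \<open>x :: real ^ 'n\<close> and \<open>t :: real\<close>;
  the space dimension is \<open>CARD('n) \<ge> 1\<close>.
\<close>

definition PV_integral :: "real ^ 'n \<Rightarrow> (real ^ 'n \<Rightarrow> real) \<Rightarrow> real" where
  "PV_integral x f = Lim (at_right 0) (\<lambda>\<epsilon>. LINT y:{y. \<epsilon> < dist x y}|lebesgue. f y)"

text \<open>
  The principal value is taken in the inner (spatial) integral, for each fixed \<open>\<tau> < t\<close>.
  On the functions admitted as classical solutions below, the limit exists for almost every \<open>\<tau>\<close>
  and the outer integral converges absolutely, so that the default values of \<^const>\<open>Lim\<close>
  and of the Lebesgue integral play no role there.
\<close>

definition master_const :: "nat \<Rightarrow> real \<Rightarrow> real" where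
  "master_const n s = 1 / ((4 * pi) powr (real n / 2) * \<bar>Gamma (- s)\<bar>)"

definition master_operator ::
    "real \<Rightarrow> (real ^ 'n \<Rightarrow> real \<Rightarrow> real) \<Rightarrow> real ^ 'n \<Rightarrow> real \<Rightarrow> real" where
  "master_operator s u x t =
     master_const CARD('n) s *
     (LINT \<tau>:{..<t}|lebesgue.
        PV_integral x (\<lambda>y. (u x t - u y \<tau>) / (t - \<tau>) powr (real CARD('n) / 2 + 1 + s)
                            * exp (- (norm (x - y))\<^sup>2 / (4 * (t - \<tau>)))))"

definition master_space :: "real \<Rightarrow> (real ^ 'n \<Rightarrow> real \<Rightarrow> real) set" where
  "master_space s = {u.
     (\<forall>K. compact K \<longrightarrow> (\<lambda>(x, t). u x t) absolutely_integrable_on K) \<and>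
     (\<forall>t. (\<integral>\<^sup>+\<tau>\<in>{..<t}.
             (\<integral>\<^sup>+x. ennreal (\<bar>u x \<tau>\<bar> * exp (- (norm x)\<^sup>2 / (4 * (t - \<tau>)))
                          / (1 + (t - \<tau>) powr (real CARD('n) / 2 + 1 + s))) \<partial>lebesgue)
           \<partial>lebesgue) < \<infinity>)}"

text \<open>
  \<open>parabolic_holder_on D \<alpha> u\<close>: the conditions defining the parabolic Hoelder space of order \<open>2 * \<alpha>\<close> in \<open>x\<close> and
  \<open>\<alpha>\<close> in \<open>t\<close>, where the
  derivatives exist on the whole space-time and the Hoelder estimates are required on \<open>D\<close>
  (with a constant that may depend on \<open>D\<close>).  For \<open>D = UNIV\<close> this is the global space.  In the
  last clause \<open>v\<close> is the time derivative and \<open>H x t\<close> the spatial Hessian matrix, whose entries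
  are required to lie in the space of order \<open>\<alpha> - 1\<close>.
\<close>

inductive parabolic_holder_on ::
    "((real ^ 'n) \<times> real) set \<Rightarrow> real \<Rightarrow> (real ^ 'n \<Rightarrow> real \<Rightarrow> real) \<Rightarrow> bool"
  for D :: "((real ^ 'n) \<times> real) set" where
  low: "parabolic_holder_on D \<alpha> u"
    if "0 < \<alpha>" "\<alpha> \<le> 1 / 2"
      and "\<exists>C>0. \<forall>(x, t)\<in>D. \<forall>(y, \<tau>)\<in>D.
             \<bar>u x t - u y \<tau>\<bar> \<le> C * (norm (x - y) + \<bar>t - \<tau>\<bar> powr (1 / 2)) powr (2 * \<alpha>)"
| middle: "parabolic_holder_on D \<alpha> u"
    if "1 / 2 < \<alpha>" "\<alpha> \<le> 1"
      and "\<exists>C>0. \<forall>x t \<tau>. (x, t) \<in> D \<longrightarrow> (x, \<tau>) \<in> D \<longrightarrow>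
             \<bar>u x t - u x \<tau>\<bar> \<le> C * \<bar>t - \<tau>\<bar> powr \<alpha>"
      and "\<forall>x t. GDERIV (\<lambda>x. u x t) x :> g x t"
      and "\<exists>C>0. \<forall>x y t. (x, t) \<in> D \<longrightarrow> (y, t) \<in> D \<longrightarrow>
             norm (g x t - g y t) \<le> C * norm (x - y) powr (2 * \<alpha> - 1)"
      and "\<exists>C>0. \<forall>x t \<tau>. (x, t) \<in> D \<longrightarrow> (x, \<tau>) \<in> D \<longrightarrow>
             norm (g x t - g x \<tau>) \<le> C * \<bar>t - \<tau>\<bar> powr (\<alpha> - 1 / 2)"
| high: "parabolic_holder_on D \<alpha> u"
    if "1 < \<alpha>"
      and "\<forall>x t. ((\<lambda>t. u x t) has_real_derivative v x t) (at t)"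
      and "\<forall>x t. GDERIV (\<lambda>x. u x t) x :> g x t"
      and "\<forall>x t. ((\<lambda>x. g x t) has_derivative (\<lambda>h. H x t *v h)) (at x)"
      and "parabolic_holder_on D (\<alpha> - 1) v"
      and "\<forall>i j. parabolic_holder_on D (\<alpha> - 1) (\<lambda>x t. H x t $ i $ j)"

definition parabolic_holder_loc :: "real \<Rightarrow> (real ^ 'n \<Rightarrow> real \<Rightarrow> real) set" where
  "parabolic_holder_loc \<alpha> = {u. \<forall>D. bounded D \<longrightarrow> parabolic_holder_on D \<alpha> u}"

text \<open>
  \<open>classical_solution s f u\<close>: \<open>u\<close> is an entire classical solution of the semilinear equation
  whose right-hand side at \<open>(x, t)\<close> is \<open>f x (u x t)\<close>.
\<close>

definition classical_solution ::
    "real \<Rightarrow> (real ^ 'n \<Rightarrow> real \<Rightarrow> real) \<Rightarrow> (real ^ 'n \<Rightarrow> real \<Rightarrow> real) \<Rightarrow> bool" where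
  "classical_solution s f u \<longleftrightarrow>
     (\<exists>\<epsilon>>0. u \<in> parabolic_holder_loc (s + \<epsilon>)) \<and> u \<in> master_space s \<and>
     (\<forall>x t. master_operator s u x t = f x (u x t))"

end

theory Submission
  imports Defs "HOL-Probability.Distributions"
begin

text \<open>
  The solution is touched from below by a multiple \<open>A > sup u\<close> of the paraboloid
  \<open>\<phi>(y, \<tau>) = 1 - |y - c|\<^sup>2 - \<tau>\<^sup>2\<close>, with \<open>c\<close> far out on the \<open>x\<^sub>1\<close>-axis.  As \<open>u > 0\<close> and
  \<open>\<phi> \<le> 0\<close> off the unit ball about \<open>(c, 0)\<close>, the function \<open>u - A \<phi>\<close> has a global minimum, attained
  in that ball.  At the minimum point the master operator of \<open>u\<close> is bounded above
  independently of \<open>c\<close>: for \<open>t - \<tau> < 1\<close> the difference \<open>u(x, t) - u(y, \<tau>)\<close> is at most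
  \<open>A (\<phi>(x, t) - \<phi>(y, \<tau>))\<close>, whose Gaussian average is \<open>O(t - \<tau>)\<close> because the linear terms in
  \<open>y - x\<close> cancel; for \<open>t - \<tau> \<ge> 1\<close> it is at most \<open>sup u\<close>.  But there the right-hand side is at
  least \<open>(c\<^sub>1 - 1) (sup u)\<^sup>p\<close>, since \<open>p < 0\<close>, and this is unbounded as \<open>c\<^sub>1\<close> grows.
\<close>

section \<open>Gaussian integrals and moments on Euclidean space\<close>

lemma integrable_exp_square_real:
  fixes c :: real
  assumes "0 < c"
  shows "integrable lborel (\<lambda>x. exp (- (c * x\<^sup>2)))"
proof -
  \<comment> \<open>The normal density of variance \<open>1 / (2 * c)\<close> has exponent
    \<open>- (c * x\<^sup>2)\<close>; the factor in front cancels its normalisation.\<close>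
  have "integrable lborel (\<lambda>x. sqrt (2 * pi * (1 / sqrt (2 * c))\<^sup>2) * normal_density 0 (1 / sqrt (2 * c)) x)"
    using assms by (intro integrable_mult_right integrable_normal_density) auto
  moreover have "sqrt (2 * pi * (1 / sqrt (2 * c))\<^sup>2) * normal_density 0 (1 / sqrt (2 * c)) x
      = exp (- (c * x\<^sup>2))" for x
    using assms by (simp add: normal_density_def power_divide field_simps)
  ultimately show ?thesis by simp
qed

text \<open>The Gaussian is the product of its one-dimensional factors over \<open>Basis\<close>, so
  finiteness of the integral reduces to the real line.\<close>

lemma integrable_exp_norm_square:
  fixes c :: real
  assumes "0 < c"
  shows "integrable lborel (\<lambda>z::'a::euclidean_space. exp (- (c * (norm z)\<^sup>2)))"
proof (rule integrableI_bounded)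
  have "(\<integral>\<^sup>+z. ennreal (norm (exp (- (c * (norm (z::'a))\<^sup>2)))) \<partial>lborel)
      = (\<integral>\<^sup>+z. (\<Prod>b\<in>Basis. ennreal (exp (- (c * (z \<bullet> b)\<^sup>2)))) \<partial>(lborel :: 'a measure))"
  proof (rule nn_integral_cong)
    fix z :: 'a
    have "(norm z)\<^sup>2 = (\<Sum>b\<in>Basis. (z \<bullet> b)\<^sup>2)"
      by (subst power2_norm_eq_inner, subst euclidean_inner) (simp add: power2_eq_square)
    then have "exp (- (c * (norm z)\<^sup>2)) = (\<Prod>b\<in>Basis. exp (- (c * (z \<bullet> b)\<^sup>2)))"
      by (simp add: sum_distrib_left sum_negf exp_sum flip: sum_negf)
    then show "ennreal (norm (exp (- (c * (norm z)\<^sup>2)))) = (\<Prod>b\<in>Basis. ennreal (exp (- (c * (z \<bullet> b)\<^sup>2))))"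
      by (simp add: prod_ennreal prod_nonneg)
  qed
  also have "\<dots> = (\<Prod>b\<in>(Basis :: 'a set). (\<integral>\<^sup>+x. ennreal (exp (- (c * x\<^sup>2))) \<partial>lborel))"
    by (rule nn_integral_lborel_prod) auto
  also have "\<dots> < \<infinity>"
    using integrableD(2)[OF integrable_exp_square_real[OF assms]]
    by (simp add: ennreal_prod_eq_top less_top power_less_top_ennreal)
  finally show "(\<integral>\<^sup>+z. ennreal (norm (exp (- (c * (norm (z::'a))\<^sup>2)))) \<partial>lborel) < \<infinity>" .
qed auto

lemma integrable_square_exp_norm_square:
  fixes c :: real
  assumes "0 < c"
  shows "integrable lborel (\<lambda>z::'a::euclidean_space. (norm z)\<^sup>2 * exp (- (c * (norm z)\<^sup>2)))"
proof (rule Bochner_Integration.integrable_bound)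
  show "integrable lborel (\<lambda>z::'a. 2 / c * exp (- (c / 2 * (norm z)\<^sup>2)))"
    using assms by (intro integrable_mult_right integrable_exp_norm_square) auto
  have "(norm z)\<^sup>2 * exp (- (c * (norm z)\<^sup>2)) \<le> 2 / c * exp (- (c / 2 * (norm z)\<^sup>2))" for z :: 'a
  proof -
    \<comment> \<open>Half of the exponential absorbs the square: \<open>a \<le> exp a\<close> with
      \<open>a = c / 2 * (norm z)\<^sup>2\<close>.\<close>
    have "c / 2 * (norm z)\<^sup>2 \<le> exp (c / 2 * (norm z)\<^sup>2)"
      by (meson exp_ge_add_one_self order_trans le_add_same_cancel2 zero_le_one less_add_one less_imp_le)
    then have "(c / 2 * (norm z)\<^sup>2) * exp (- (c * (norm z)\<^sup>2))
        \<le> exp (c / 2 * (norm z)\<^sup>2) * exp (- (c * (norm z)\<^sup>2))"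
      by (rule mult_right_mono) auto
    also have "\<dots> = exp (- (c / 2 * (norm z)\<^sup>2))"
      by (simp flip: exp_add)
    finally show ?thesis using assms by (simp add: field_simps)
  qed
  then show "AE z in lborel. norm ((norm (z::'a))\<^sup>2 * exp (- (c * (norm z)\<^sup>2)))
      \<le> norm (2 / c * exp (- (c / 2 * (norm z)\<^sup>2)))"
    using assms by (auto simp: abs_mult)
qed auto

lemma integrable_inner_exp_norm_square:
  fixes c :: real and v :: "'a::euclidean_space"
  assumes "0 < c"
  shows "integrable lborel (\<lambda>z. (z \<bullet> v) * exp (- (c * (norm z)\<^sup>2)))"
proof (rule Bochner_Integration.integrable_bound)
  show "integrable lborel (\<lambda>z::'a. norm v * (exp (- (c * (norm z)\<^sup>2)) + (norm z)\<^sup>2 * exp (- (c * (norm z)\<^sup>2))))"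
    by (intro integrable_mult_right Bochner_Integration.integrable_add
        integrable_exp_norm_square integrable_square_exp_norm_square assms)
  have "\<bar>z \<bullet> v\<bar> \<le> norm v * (1 + (norm z)\<^sup>2)" for z
  proof -
    \<comment> \<open>From \<open>(norm z - 1)\<^sup>2 \<ge> 0\<close>. With Cauchy-Schwarz this
      trades the linear factor for the two integrands already treated.\<close>
    have "norm z \<le> 1 + (norm z)\<^sup>2"
      using zero_le_power2[of "norm z - 1"] norm_ge_zero[of z]
      unfolding power2_diff one_power2 mult_1_right by linarith
    then have "norm z * norm v \<le> norm v * (1 + (norm z)\<^sup>2)"
      by (subst mult.commute) (rule mult_left_mono, auto)
    then show ?thesis using Cauchy_Schwarz_ineq2[of z v] by linarith
  qed
  then have "\<bar>z \<bullet> v\<bar> * exp (- (c * (norm z)\<^sup>2)) \<le> norm v * (1 + (norm z)\<^sup>2) * exp (- (c * (norm z)\<^sup>2))" for z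
    by (intro mult_right_mono) auto
  then show "AE z in lborel. norm ((z \<bullet> v) * exp (- (c * (norm z)\<^sup>2)))
      \<le> norm (norm v * (exp (- (c * (norm z)\<^sup>2)) + (norm z)\<^sup>2 * exp (- (c * (norm z)\<^sup>2))))"
    by (auto simp: abs_mult algebra_simps)
qed auto

lemma lborel_integral_affine:
  fixes f :: "'a::euclidean_space \<Rightarrow> real"
  assumes [measurable]: "f \<in> borel_measurable borel" and c: "c \<noteq> 0"
  shows "(LINT x|lborel. f x) = \<bar>c\<bar> ^ DIM('a) * (LINT x|lborel. f (a + c *\<^sub>R x))"
  by (subst lborel_affine[OF c, of a]) (simp add: integral_density integral_distr)

text \<open>The integrand is odd, so reflection in the origin turns the integral into its own
  negative. This removes the first-order terms from Gaussian averages.\<close>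

lemma integral_inner_exp_norm_square:
  fixes c :: real and v :: "'a::euclidean_space"
  shows "(LINT z|lborel. (z \<bullet> v) * exp (- (c * (norm z)\<^sup>2))) = 0"
  using lborel_integral_affine[of "\<lambda>z. (z \<bullet> v) * exp (- (c * (norm z)\<^sup>2))" "-1" 0] by simp

section \<open>Principal values of integrable functions\<close>

text \<open>Dominated convergence with majorant \<open>norm (f y)\<close>: every
  \<open>y \<noteq> x\<close> eventually lies outside the excised ball, and the point
  \<open>x\<close> is null. This evaluates the \<open>Lim\<close> in \<open>PV_integral\<close>,
  because for \<tau> < t the Gaussian kernel is not singular and a bounded difference is integrable
  against it.\<close>

lemma PV_integral_eq_integral:
  fixes f :: "real ^ 'n \<Rightarrow> real"
  assumes f: "integrable lebesgue f"
  shows "PV_integral x f = (LINT y|lebesgue. f y)"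
proof -
  have "((\<lambda>\<epsilon>. LINT y:{y. \<epsilon> < dist x y}|lebesgue. f y) \<longlongrightarrow> (LINT y|lebesgue. f y)) (at_right 0)"
    unfolding tendsto_at_iff_sequentially
  proof (intro allI impI)
    fix X :: "nat \<Rightarrow> real"
    assume X: "\<forall>i. X i \<in> {0<..} - {0}" "X \<longlonglongrightarrow> 0"
    have "(\<lambda>i. LINT y|lebesgue. indicator {y. X i < dist x y} y *\<^sub>R f y) \<longlonglongrightarrow> (LINT y|lebesgue. f y)"
    proof (rule integral_dominated_convergence[where w = "\<lambda>y. norm (f y)"])
      show "f \<in> borel_measurable lebesgue" using f by auto
      have "{y. X i < dist x y} \<in> sets borel" for i
        by measurable
      then have "{y. X i < dist x y} \<in> sets lebesgue" for i
        by (metis sets_completionI_sets sets_lborel)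
      then show "(\<lambda>y. indicator {y. X i < dist x y} y *\<^sub>R f y) \<in> borel_measurable lebesgue" for i
        using f by (intro borel_measurable_scaleR borel_measurable_indicator) auto
      show "integrable lebesgue (\<lambda>y. norm (f y))" using f by auto
      have "(\<lambda>i. indicator {y. X i < dist x y} y *\<^sub>R f y) \<longlonglongrightarrow> f y" if "y \<noteq> x" for y
      proof (rule tendsto_eventually)
        have "eventually (\<lambda>i. X i < dist x y) sequentially"
          using X(2) that by (intro order_tendstoD(2)[where y = 0]) auto
        then show "eventually (\<lambda>i. indicator {y. X i < dist x y} y *\<^sub>R f y = f y) sequentially"
          by eventually_elim auto
      qed
      moreover have "AE y in lebesgue. y \<noteq> x"
        using AE_lborel_singleton[of x] by (rule AE_completion)
      ultimately show "AE y in lebesgue. (\<lambda>i. indicator {y. X i < dist x y} y *\<^sub>R f y) \<longlonglongrightarrow> f y"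
        by (auto elim: eventually_mono)
    qed (auto simp: indicator_def)
    then show "((\<lambda>\<epsilon>. LINT y:{y. \<epsilon> < dist x y}|lebesgue. f y) \<circ> X) \<longlonglongrightarrow> (LINT y|lebesgue. f y)"
      by (simp add: o_def set_lebesgue_integral_def)
  qed
  then show ?thesis unfolding PV_integral_def by (intro tendsto_Lim) auto
qed

section \<open>Continuity of parabolic Hoelder functions\<close>

text \<open>Split \<open>f y \<tau> - f x t\<close> into \<open>f y \<tau> - f y t\<close> and
  \<open>f y t - f x t\<close>: the first is small uniformly in \<open>y\<close>, the second by
  continuity of the slice at time \<open>t\<close>.\<close>

lemma continuous_on_Times_slicewise:
  fixes f :: "'a::metric_space \<Rightarrow> real \<Rightarrow> real"
  assumes x: "\<And>t. t \<in> T \<Longrightarrow> continuous_on S (\<lambda>x. f x t)"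
    and t: "\<And>x t \<tau>. x \<in> S \<Longrightarrow> t \<in> T \<Longrightarrow> \<tau> \<in> T \<Longrightarrow> \<bar>f x t - f x \<tau>\<bar> \<le> C * \<bar>t - \<tau>\<bar> powr \<beta>"
    and "0 < \<beta>"
  shows "continuous_on (S \<times> T) (\<lambda>(x, t). f x t)"
  unfolding continuous_on_def
proof (rule ballI)
  fix z assume z: "z \<in> S \<times> T"
  obtain x t where zt: "z = (x, t)" "x \<in> S" "t \<in> T" using z by auto
  have fst: "(fst \<longlongrightarrow> x) (at z within S \<times> T)" and snd: "(snd \<longlongrightarrow> t) (at z within S \<times> T)"
    using tendsto_fst[OF tendsto_ident_at[of z "S \<times> T"]] tendsto_snd[OF tendsto_ident_at[of z "S \<times> T"]]
    by (auto simp: zt(1))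
  have "continuous_on (S \<times> T) (\<lambda>p. f (fst p) t)"
    by (rule continuous_on_compose2[OF x[OF zt(3)]]) (auto intro: continuous_intros)
  then have 1: "((\<lambda>p. f (fst p) t) \<longlongrightarrow> f x t) (at z within S \<times> T)"
    using z by (auto simp: continuous_on_def zt(1))
  have "((\<lambda>p. C * \<bar>snd p - t\<bar> powr \<beta>) \<longlongrightarrow> C * \<bar>t - t\<bar> powr \<beta>) (at z within S \<times> T)"
    using \<open>0 < \<beta>\<close> by (intro tendsto_intros snd tendsto_powr2) auto
  then have lim: "((\<lambda>p. C * \<bar>snd p - t\<bar> powr \<beta>) \<longlongrightarrow> 0) (at z within S \<times> T)"
    using \<open>0 < \<beta>\<close> by simp
  have 2: "((\<lambda>p. f (fst p) (snd p) - f (fst p) t) \<longlongrightarrow> 0) (at z within S \<times> T)"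
    by (rule Lim_null_comparison[OF _ lim])
      (use t zt in \<open>auto simp: eventually_at_filter intro!: always_eventually\<close>)
  show "((\<lambda>(x, t). f x t) \<longlongrightarrow> (case z of (x, t) \<Rightarrow> f x t)) (at z within S \<times> T)"
    using tendsto_add[OF 2 1] by (simp add: zt(1) case_prod_beta')
qed

lemma GDERIV_continuous_on:
  assumes "\<And>x. GDERIV f x :> g x"
  shows "continuous_on S f"
  using assms unfolding gderiv_def
  by (intro continuous_at_imp_continuous_on ballI has_derivative_continuous) blast

text \<open>On a product domain the separate information in space and in time combines to joint
  continuity. Compactness and the interval as time factor serve the clause
  \<open>high\<close>.\<close>

lemma parabolic_holder_on_imp_continuous_on:
  fixes u :: "real ^ 'n \<Rightarrow> real \<Rightarrow> real"
  assumes "parabolic_holder_on D \<alpha> u" "D = S \<times> {a..b}" "compact S"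
  shows "continuous_on D (\<lambda>(x, t). u x t)"
  using assms
proof (induction rule: parabolic_holder_on.induct)
  case (low \<alpha> u)
  then obtain C where C: "\<And>x t y \<tau>. (x, t) \<in> D \<Longrightarrow> (y, \<tau>) \<in> D \<Longrightarrow>
      \<bar>u x t - u y \<tau>\<bar> \<le> C * (norm (x - y) + \<bar>t - \<tau>\<bar> powr (1 / 2)) powr (2 * \<alpha>)"
    by fast
  show ?case unfolding continuous_on_def
  proof (rule ballI)
    fix z assume z: "z \<in> D"
    have fst: "(fst \<longlongrightarrow> fst z) (at z within D)" and snd: "(snd \<longlongrightarrow> snd z) (at z within D)"
      by (auto intro!: tendsto_intros)
    have "((\<lambda>p. C * (norm (fst p - fst z) + \<bar>snd p - snd z\<bar> powr (1 / 2)) powr (2 * \<alpha>)) \<longlongrightarrow>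
        C * (norm (fst z - fst z) + \<bar>snd z - snd z\<bar> powr (1 / 2)) powr (2 * \<alpha>)) (at z within D)"
      using low by (intro tendsto_intros fst snd tendsto_powr2) (auto intro!: always_eventually)
    then have lim: "((\<lambda>p. C * (norm (fst p - fst z) + \<bar>snd p - snd z\<bar> powr (1 / 2)) powr (2 * \<alpha>)) \<longlongrightarrow> 0)
        (at z within D)"
      using low by simp
    have "((\<lambda>p. u (fst p) (snd p) - u (fst z) (snd z)) \<longlongrightarrow> 0) (at z within D)"
      by (rule Lim_null_comparison[OF _ lim]) (use C z in \<open>auto simp: eventually_at_filter\<close>)
    then show "((\<lambda>(x, t). u x t) \<longlongrightarrow> (case z of (x, t) \<Rightarrow> u x t)) (at z within D)"
      by (simp add: case_prod_beta' LIM_zero_iff)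
  qed
next
  case (middle \<alpha> u g)
  then obtain C where "\<And>x t \<tau>. (x, t) \<in> D \<Longrightarrow> (x, \<tau>) \<in> D \<Longrightarrow> \<bar>u x t - u x \<tau>\<bar> \<le> C * \<bar>t - \<tau>\<bar> powr \<alpha>"
    by blast
  moreover have "continuous_on S (\<lambda>x. u x t)" for t
    using middle.hyps by (intro GDERIV_continuous_on[where g = "\<lambda>x. g x t"]) blast
  ultimately show ?case
    using middle unfolding middle.prems(1)
    by (intro continuous_on_Times_slicewise[where C = C and \<beta> = \<alpha>]) auto
next
  case (high \<alpha> u v g H)
  \<comment> \<open>By the induction hypothesis \<open>v\<close> is continuous, hence bounded on
    \<open>D\<close>; the mean value inequality then makes \<open>u\<close> Lipschitz in time,
    uniformly over \<open>S\<close>.\<close>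
  have "compact D" using high.prems by (auto intro: compact_Times)
  then have "bounded ((\<lambda>(x, t). v x t) ` D)"
    using high by (intro compact_imp_bounded compact_continuous_image) auto
  then obtain C where C: "\<And>x t. (x, t) \<in> D \<Longrightarrow> \<bar>v x t\<bar> \<le> C"
    unfolding bounded_iff by force
  have "\<bar>u x t - u x \<tau>\<bar> \<le> C * \<bar>t - \<tau>\<bar>" if "x \<in> S" "t \<in> {a..b}" "\<tau> \<in> {a..b}" for x t \<tau>
    using field_differentiable_bound[of "{a..b}" "u x" "v x" C t \<tau>] that high C
    by (auto simp: has_field_derivative_at_within dist_norm)
  moreover have "continuous_on S (\<lambda>x. u x t)" for t
    using high.hyps by (intro GDERIV_continuous_on[where g = "\<lambda>x. g x t"]) blast
  ultimately show ?case
    unfolding high.prems(1)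
    by (intro continuous_on_Times_slicewise[where C = C and \<beta> = 1]) auto
qed

text \<open>Every point is interior to a compact cylinder. Continuity serves twice: it makes time
  slices Borel measurable, and it lets the difference of solution and paraboloid attain a minimum on
  a closed ball.\<close>

lemma parabolic_holder_loc_imp_continuous_on:
  fixes u :: "real ^ 'n \<Rightarrow> real \<Rightarrow> real"
  assumes "u \<in> parabolic_holder_loc \<alpha>"
  shows "continuous_on UNIV (\<lambda>(x, t). u x t)"
proof (rule continuous_at_imp_continuous_on, rule ballI)
  fix z :: "(real ^ 'n) \<times> real"
  let ?D = "cball (fst z) 1 \<times> {snd z - 1..snd z + 1}"
  have "continuous_on ?D (\<lambda>(x, t). u x t)"
    using assms by (intro parabolic_holder_on_imp_continuous_on[where \<alpha> = \<alpha>])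
      (auto simp: parabolic_holder_loc_def bounded_Times)
  then have "continuous_on (ball (fst z) 1 \<times> {snd z - 1<..<snd z + 1}) (\<lambda>(x, t). u x t)"
    by (rule continuous_on_subset) auto
  then show "isCont (\<lambda>(x, t). u x t) z"
    by (rule continuous_on_interior)
      (auto simp: interior_open open_Times mem_Times_iff)
qed

section \<open>Upper bound for the master operator at a touching point\<close>

text \<open>Under \<open>y = x + sqrt r *\<^sub>R z\<close> the weight becomes a fixed Gaussian, and
  the Jacobian \<open>sqrt r ^ CARD('n)\<close> cancels the dimensional power of \<open>r\<close> in
  the kernel. With \<open>\<beta> = 1 + s\<close> the left side is the inner integral of the master
  operator at elapsed time \<open>r = t - \<tau>\<close>.\<close>

lemma heat_average:
  fixes w :: "real ^ 'n \<Rightarrow> real" and \<beta> :: real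
  assumes w[measurable]: "w \<in> borel_measurable borel" and bound: "\<And>y. \<bar>w y\<bar> \<le> M" and r: "0 < r"
  shows "PV_integral x (\<lambda>y. w y / r powr (real CARD('n) / 2 + \<beta>) * exp (- (norm (x - y))\<^sup>2 / (4 * r)))
    = r powr (- \<beta>) * (LINT z|lborel. w (x + sqrt r *\<^sub>R z) * exp (- (1 / 4 * (norm z)\<^sup>2)))"
proof -
  let ?f = "\<lambda>y. w y / r powr (real CARD('n) / 2 + \<beta>) * exp (- (norm (x - y))\<^sup>2 / (4 * r))"
  have shift: "?f (x + sqrt r *\<^sub>R z)
      = r powr (- (real CARD('n) / 2 + \<beta>)) * (w (x + sqrt r *\<^sub>R z) * exp (- (1 / 4 * (norm z)\<^sup>2)))" for z
    using r by (simp add: power_mult_distrib powr_minus divide_simps)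
  have "integrable lborel (\<lambda>y. exp (- (1 / (4 * r) * (norm y)\<^sup>2)))" (is "integrable lborel ?e")
    using r by (intro integrable_exp_norm_square) auto
  then have "integrable (distr lborel borel (\<lambda>y. - x + y)) ?e"
    unfolding lborel_distr_plus .
  then have "integrable lborel (\<lambda>y. ?e (- x + y))"
    by (subst (asm) integrable_distr_eq) auto
  then have "integrable lborel (\<lambda>y. M / r powr (real CARD('n) / 2 + \<beta>) * ?e (- x + y))"
    by (rule integrable_mult_right)
  then have "integrable lborel ?f"
  proof (rule Bochner_Integration.integrable_bound)
    have "norm (?f y) \<le> norm (M / r powr (real CARD('n) / 2 + \<beta>) * ?e (- x + y))" for y
    proof -
      have "norm (?f y) = \<bar>w y\<bar> / r powr (real CARD('n) / 2 + \<beta>) * ?e (- x + y)"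
        by (simp add: abs_mult norm_minus_commute)
      also have "\<dots> \<le> M / r powr (real CARD('n) / 2 + \<beta>) * ?e (- x + y)"
        using bound by (intro mult_right_mono divide_right_mono) auto
      also have "\<dots> \<le> norm \<dots>"
        by (simp only: real_norm_def abs_ge_self)
      finally show ?thesis .
    qed
    then show "AE y in lborel. norm (?f y) \<le> norm (M / r powr (real CARD('n) / 2 + \<beta>) * ?e (- x + y))"
      by simp
  qed measurable
  then have "PV_integral x ?f = (LINT y|lebesgue. ?f y)"
    by (intro PV_integral_eq_integral) (simp add: integrable_completion)
  also have "\<dots> = (LINT y|lborel. ?f y)"
    by (intro integral_completion) measurable
  also have "\<dots> = sqrt r ^ CARD('n) * (LINT z|lborel. ?f (x + sqrt r *\<^sub>R z))"
    using r by (subst lborel_integral_affine[where c = "sqrt r" and a = x]) auto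
  also have "\<dots> = sqrt r ^ CARD('n) * r powr (- (real CARD('n) / 2 + \<beta>))
      * (LINT z|lborel. w (x + sqrt r *\<^sub>R z) * exp (- (1 / 4 * (norm z)\<^sup>2)))"
    unfolding shift by simp
  also have "sqrt r ^ CARD('n) * r powr (- (real CARD('n) / 2 + \<beta>)) = r powr (- \<beta>)"
    using r by (simp add: powr_half_sqrt [symmetric] powr_powr flip: powr_realpow powr_add)
  finally show ?thesis .
qed

text \<open>Up to a constant, \<open>h\<close> will dominate the time integrand from above as a
  function of elapsed time: \<open>s < 1\<close> gives integrability at 0, and \<open>0 < s\<close>
  at infinity.\<close>

lemma integrable_time_kernel:
  fixes s :: real
  assumes "0 < s" "s < 1"
  defines "h \<equiv> \<lambda>r. indicator {0<..1} r * r powr (- s) + indicator {1..} r * r powr (- 1 - s)"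
  shows "integrable lborel h"
proof -
  have "(\<lambda>r. r powr (- s)) absolutely_integrable_on {0<..1}"
    using assms by (intro nonnegative_absolutely_integrable_1 integrable_on_powr_from_0') auto
  moreover have "(\<lambda>r. r powr (- 1 - s)) absolutely_integrable_on {1..}"
    using assms has_integral_powr_to_inf[of "- 1 - s" 1]
    by (intro nonnegative_absolutely_integrable_1) auto
  ultimately have "integrable lebesgue h"
    unfolding h_def set_integrable_def by auto
  then show ?thesis
    unfolding h_def by (subst (asm) integrable_completion) measurable
qed

lemma norm_add_scaleR_square:
  fixes a z :: "'a::real_inner"
  shows "(norm (a + k *\<^sub>R z))\<^sup>2 = (norm a)\<^sup>2 + 2 * k * (z \<bullet> a) + k\<^sup>2 * (norm z)\<^sup>2"
  unfolding power2_norm_eq_inner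
  by (simp add: inner_add_left inner_add_right inner_commute[of a z] power2_eq_square distrib_left)

text \<open>The order of quantifiers is the point: \<open>K\<close> is fixed before
  \<open>u\<close>, \<open>x\<close>, \<open>t\<close> and \<open>c\<close>, so the centre of the
  paraboloid can later be chosen in terms of \<open>K\<close>.\<close>

lemma master_operator_le_at_touching_point:
  fixes s A M :: real
  assumes s: "0 < s" "s < 1" and A: "0 \<le> A"
  shows "\<exists>K. \<forall>(u :: real ^ 'n \<Rightarrow> real \<Rightarrow> real) x t c.
    continuous_on UNIV (\<lambda>(x, t). u x t) \<longrightarrow> (\<forall>x t. 0 < u x t \<and> u x t \<le> M) \<longrightarrow> \<bar>t\<bar> \<le> 1 \<longrightarrow>
    (\<forall>y \<tau>. u x t - u y \<tau> \<le> A * ((norm (y - c))\<^sup>2 - (norm (x - c))\<^sup>2 + \<tau>\<^sup>2 - t\<^sup>2)) \<longrightarrow>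
    master_operator s u x t \<le> K"
proof (intro exI allI impI)
  define e where "e = (\<lambda>z :: real ^ 'n. exp (- (1 / 4 * (norm z)\<^sup>2)))"
  define h where "h = (\<lambda>r. indicator {0<..1} r * r powr (- s) + indicator {1..} r * r powr (- 1 - s))"
  define I0 I2 where "I0 = (LINT z|lborel. e z)" and "I2 = (LINT z|lborel. (norm z)\<^sup>2 * e z)"
  \<comment> \<open>The sum of the constants for short and for long elapsed times, so that it serves
    for both.\<close>
  define B where "B = A * (I2 + 3 * I0) + M * I0"
  have e: "integrable lborel e" "integrable lborel (\<lambda>z. (norm z)\<^sup>2 * e z)"
    "\<And>v. integrable lborel (\<lambda>z. (z \<bullet> v) * e z)"
    unfolding e_def
    by (intro integrable_exp_norm_square integrable_square_exp_norm_square
        integrable_inner_exp_norm_square, simp)+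
  have odd: "(LINT z|lborel. (z \<bullet> v) * e z) = 0" for v
    unfolding e_def by (rule integral_inner_exp_norm_square)
  have e_pos: "0 < e z" for z by (simp add: e_def)
  have I: "0 \<le> I0" "0 \<le> I2"
    using e_pos by (auto simp: I0_def I2_def less_imp_le intro!: integral_nonneg_AE)
  have h: "integrable lborel h"
    unfolding h_def by (rule integrable_time_kernel[OF s])
  have h_nonneg: "0 \<le> h r" for r by (simp add: h_def)
  fix u :: "real ^ 'n \<Rightarrow> real \<Rightarrow> real" and x c and t :: real
  assume cont: "continuous_on UNIV (\<lambda>(x, t). u x t)" and u: "\<forall>x t. 0 < u x t \<and> u x t \<le> M"
    and t: "\<bar>t\<bar> \<le> 1"
    and touch: "\<forall>y \<tau>. u x t - u y \<tau> \<le> A * ((norm (y - c))\<^sup>2 - (norm (x - c))\<^sup>2 + \<tau>\<^sup>2 - t\<^sup>2)"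
  have M: "0 < M" using u by (meson less_le_trans)
  have B: "0 \<le> B" using A M I by (simp add: B_def)
  define F where "F = (\<lambda>\<tau>. PV_integral x (\<lambda>y. (u x t - u y \<tau>) / (t - \<tau>) powr (real CARD('n) / 2 + 1 + s)
                            * exp (- (norm (x - y))\<^sup>2 / (4 * (t - \<tau>)))))"
  have F_le: "F \<tau> \<le> B * h (t - \<tau>)" if "\<tau> < t" for \<tau>
  proof -
    define r where "r = t - \<tau>"
    define w where "w = (\<lambda>y. u x t - u y \<tau>)"
    have r: "0 < r" "\<tau> = t - r" using that by (auto simp: r_def)
    have "continuous_on UNIV (\<lambda>y. u y \<tau>)"
      using continuous_on_compose2[OF cont, of UNIV "\<lambda>y. (y, \<tau>)"]
      by (simp add: continuous_on_Pair continuous_on_id)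
    then have meas[measurable]: "w \<in> borel_measurable borel"
      unfolding w_def by (intro borel_measurable_continuous_onI continuous_intros)
    have w_abs: "\<bar>w y\<bar> \<le> M" for y
      using u[rule_format, of x t] u[rule_format, of y \<tau>] by (simp add: w_def abs_le_iff)
    let ?J = "LINT z|lborel. w (x + sqrt r *\<^sub>R z) * e z"
    have F_eq: "F \<tau> = r powr (- 1 - s) * ?J"
      using heat_average[OF meas w_abs r(1), where \<beta> = "1 + s" and x = x]
      by (simp add: F_def w_def r_def e_def add.assoc)
    have int: "integrable lborel (\<lambda>z. w (x + sqrt r *\<^sub>R z) * e z)"
    proof (rule Bochner_Integration.integrable_bound)
      show "integrable lborel (\<lambda>z. M * e z)" using e by simp
      show "AE z in lborel. norm (w (x + sqrt r *\<^sub>R z) * e z) \<le> norm (M * e z)"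
        using w_abs M e_pos by (intro always_eventually) (simp add: abs_mult mult_right_mono)
    qed (simp add: e_def)
    have "?J \<le> (LINT z|lborel. M * e z)"
      using e int w_abs e_pos
      by (intro integral_mono mult_right_mono) (auto simp: abs_le_iff less_imp_le)
    then have far: "?J \<le> M * I0" by (simp add: I0_def)
    have near: "?J \<le> r * (A * (I2 + 3 * I0))" if "r \<le> 1"
    proof -
      have "w (x + sqrt r *\<^sub>R z) \<le> A * (2 * sqrt r * (z \<bullet> (x - c)) + r * (norm z)\<^sup>2 + 3 * r)" for z
      proof -
        have "(norm (x + sqrt r *\<^sub>R z - c))\<^sup>2 = (norm ((x - c) + sqrt r *\<^sub>R z))\<^sup>2"
          by (simp add: algebra_simps)
        also have "\<dots> = (norm (x - c))\<^sup>2 + 2 * sqrt r * (z \<bullet> (x - c)) + r * (norm z)\<^sup>2"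
          using r by (simp add: norm_add_scaleR_square)
        finally have sp: "(norm (x + sqrt r *\<^sub>R z - c))\<^sup>2
            = (norm (x - c))\<^sup>2 + 2 * sqrt r * (z \<bullet> (x - c)) + r * (norm z)\<^sup>2" .
        have "\<tau>\<^sup>2 - t\<^sup>2 = r * (r - 2 * t)"
          by (simp add: r(2) power2_eq_square algebra_simps)
        \<comment> \<open>Here \<open>r \<le> 1\<close> and \<open>\<bar>t\<bar> \<le> 1\<close>
          enter; this is the source of the 3 in \<open>B\<close>.\<close>
        also have "\<dots> \<le> r * 3"
          using r that t by (intro mult_left_mono) auto
        finally have "(norm (x + sqrt r *\<^sub>R z - c))\<^sup>2 - (norm (x - c))\<^sup>2 + \<tau>\<^sup>2 - t\<^sup>2
            \<le> 2 * sqrt r * (z \<bullet> (x - c)) + r * (norm z)\<^sup>2 + 3 * r"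
          unfolding sp by simp
        from mult_left_mono[OF this A] touch show ?thesis
          unfolding w_def by (meson order_trans)
      qed
      from mult_right_mono[OF this less_imp_le[OF e_pos]]
      have le: "w (x + sqrt r *\<^sub>R z) * e z
          \<le> 2 * sqrt r * A * ((z \<bullet> (x - c)) * e z) + r * A * ((norm z)\<^sup>2 * e z) + 3 * r * A * e z" for z
        by (simp add: algebra_simps)
      \<comment> \<open>The linear term is only of order \<open>sqrt r\<close> and carries
        \<open>x - c\<close>, but it integrates to 0 by oddness. What remains is of order
        \<open>r\<close> and free of \<open>c\<close>.\<close>
      have "?J \<le> (LINT z|lborel.
          2 * sqrt r * A * ((z \<bullet> (x - c)) * e z) + r * A * ((norm z)\<^sup>2 * e z) + 3 * r * A * e z)"
        by (intro integral_mono int le Bochner_Integration.integrable_add integrable_mult_right e)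
      also have "\<dots> = r * A * I2 + 3 * r * A * I0"
        using e by (simp add: I0_def I2_def odd)
      finally show ?thesis by (simp add: algebra_simps)
    qed
    show ?thesis
    proof (cases "r < 1")
      case True
      have "F \<tau> \<le> r powr (- 1 - s) * (r * (A * (I2 + 3 * I0)))"
        unfolding F_eq using near True by (intro mult_left_mono) auto
      also have "\<dots> = r powr (- s) * (A * (I2 + 3 * I0))"
        using r powr_add[of r "- 1 - s" 1] by simp
      also have "\<dots> \<le> r powr (- s) * B"
        using M I by (intro mult_left_mono) (auto simp: B_def)
      also have "r powr (- s) = h r" using True r(1) by (simp add: h_def)
      finally show ?thesis by (simp only: r_def mult.commute)
    next
      case False
      have "F \<tau> \<le> r powr (- 1 - s) * B"
        unfolding F_eq using far A I
        by (intro mult_left_mono) (auto simp: B_def intro: add_increasing)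
      \<comment> \<open>Only an inequality: at \<open>r = 1\<close> both indicators in
        \<open>h\<close> contribute.\<close>
      also have "\<dots> \<le> h r * B"
        using B False by (intro mult_right_mono) (auto simp: h_def)
      finally show ?thesis by (simp only: r_def mult.commute)
    qed
  qed
  have h_shift: "integrable lebesgue (\<lambda>\<tau>. h (t - \<tau>))" "(LINT \<tau>|lebesgue. h (t - \<tau>)) = (LINT r|lborel. h r)"
  proof -
    have [measurable]: "(\<lambda>\<tau>. h (t - \<tau>)) \<in> borel_measurable lborel"
      unfolding h_def by measurable
    show "integrable lebesgue (\<lambda>\<tau>. h (t - \<tau>))"
      using lborel_integrable_real_affine[OF h, of "-1" t] by (simp add: integrable_completion)
    show "(LINT \<tau>|lebesgue. h (t - \<tau>)) = (LINT r|lborel. h r)"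
      using lborel_integral_real_affine[of "-1" h t] by (simp add: integral_completion)
  qed
  have "(LINT \<tau>:{..<t}|lebesgue. F \<tau>) \<le> B * (LINT r|lborel. h r)"
  proof (cases "set_integrable lebesgue {..<t} F")
    case True
    have "(LINT \<tau>:{..<t}|lebesgue. F \<tau>) \<le> (LINT \<tau>|lebesgue. B * h (t - \<tau>))"
      unfolding set_lebesgue_integral_def
      using True h_shift F_le B h_nonneg
      by (intro integral_mono) (auto simp: set_integrable_def indicator_def)
    then show ?thesis by (simp add: h_shift)
  next
    case False \<comment> \<open>the Lebesgue integral then takes the default value 0\<close>
    then have "(LINT \<tau>:{..<t}|lebesgue. F \<tau>) = 0"
      by (simp add: set_integrable_def set_lebesgue_integral_def not_integrable_integral_eq)
    then show ?thesis using B h_nonneg by simp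
  qed
  then show "master_operator s u x t \<le> master_const CARD('n) s * (B * (LINT r|lborel. h r))"
    unfolding master_operator_def F_def by (intro mult_left_mono) (auto simp: master_const_def)
qed

section \<open>Contradiction from a paraboloid centred far out on the axis\<close>

theorem theorem1p4:
  fixes s p :: real and i :: "'n::finite"
  assumes "0 < s" and "s < 1" and "p < 0"
  shows "\<not> (\<exists>u :: real ^ 'n \<Rightarrow> real \<Rightarrow> real.
            classical_solution s (\<lambda>x r. x $ i * r powr p) u \<and>
            (\<forall>x t. 0 < u x t) \<and>
            bdd_above (range (\<lambda>(x, t). u x t)))"
proof
  assume "\<exists>u :: real ^ 'n \<Rightarrow> real \<Rightarrow> real.
            classical_solution s (\<lambda>x r. x $ i * r powr p) u \<and>
            (\<forall>x t. 0 < u x t) \<and>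
            bdd_above (range (\<lambda>(x, t). u x t))"
  then obtain u :: "real ^ 'n \<Rightarrow> real \<Rightarrow> real" and M
    where sol: "classical_solution s (\<lambda>x r. x $ i * r powr p) u"
      and pos: "\<And>x t. 0 < u x t" and le: "\<And>x t. u x t \<le> M"
    by (auto simp: bdd_above_def)
  have M: "0 < M" using pos le by (meson less_le_trans)
  have cont: "continuous_on UNIV (\<lambda>(x, t). u x t)"
    using sol parabolic_holder_loc_imp_continuous_on by (auto simp: classical_solution_def)
  \<comment> \<open>Larger than \<open>M\<close>, so that \<open>u - A * \<phi>\<close> is negative
    at the apex \<open>(c, 0)\<close>, where \<phi> is 1.\<close>
  define A where "A = M + 1"
  obtain K where K: "\<And>x t c. \<bar>t\<bar> \<le> 1 \<Longrightarrow>
      (\<And>y \<tau>. u x t - u y \<tau> \<le> A * ((norm (y - c))\<^sup>2 - (norm (x - c))\<^sup>2 + \<tau>\<^sup>2 - t\<^sup>2)) \<Longrightarrow>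
      master_operator s u x t \<le> K"
    using master_operator_le_at_touching_point[OF assms(1,2), of A M] M cont pos le
    unfolding A_def by (metis add_nonneg_nonneg less_imp_le zero_le_one)
  \<comment> \<open>Chosen so that \<open>(R - 1) * M powr p\<close> equals
    \<open>M powr p + \<bar>K\<bar>\<close>, which exceeds \<open>K\<close>; the touching point has
    \<open>i\<close>-th coordinate at least \<open>R - 1\<close>.\<close>
  define R where "R = 2 + \<bar>K\<bar> / M powr p"
  define c :: "real ^ 'n" where "c = axis i R"
  define w where "w = (\<lambda>z. u (fst z) (snd z) - A * (1 - (norm (fst z - c))\<^sup>2 - (snd z)\<^sup>2))"
  \<comment> \<open>The unit ball of the product metric is exactly the set where \<phi> is
    nonnegative.\<close>
  have ball: "z \<in> cball (c, 0) 1 \<longleftrightarrow> (norm (fst z - c))\<^sup>2 + (snd z)\<^sup>2 \<le> 1" for z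
    by (simp add: dist_prod_def dist_norm norm_minus_commute split: prod.split)
  have "continuous_on (cball (c, 0) 1) (\<lambda>z. u (fst z) (snd z))"
    using cont by (auto simp: case_prod_beta' intro: continuous_on_subset)
  then have "continuous_on (cball (c, 0) 1) w"
    unfolding w_def by (intro continuous_intros)
  then obtain z where z: "z \<in> cball (c, 0) 1" "\<And>y. y \<in> cball (c, 0) 1 \<Longrightarrow> w z \<le> w y"
    using continuous_attains_inf[of "cball (c, 0::real) 1" w] by auto
  have "w z \<le> w (c, 0)" by (rule z) simp
  also have "\<dots> < 0" using le[of c 0] by (simp add: w_def A_def)
  finally have neg: "w z < 0" .
  \<comment> \<open>Off the ball \<open>w\<close> is at least \<open>u\<close>, hence positive,
    while \<open>w z\<close> is negative; so the minimum over the ball is global.\<close>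
  have min: "w z \<le> w y" for y
  proof (cases "y \<in> cball (c, 0) 1")
    case False
    then have "A * (1 - (norm (fst y - c))\<^sup>2 - (snd y)\<^sup>2) \<le> 0"
      using M unfolding ball A_def by (intro mult_nonneg_nonpos) auto
    then show ?thesis using neg pos[of "fst y" "snd y"] by (simp add: w_def)
  qed (use z in blast)
  obtain x t where xt: "z = (x, t)" by (cases z)
  have dist: "(norm (x - c))\<^sup>2 + t\<^sup>2 \<le> 1" using z(1) unfolding ball xt by simp
  have "t\<^sup>2 \<le> 1" "(norm (x - c))\<^sup>2 \<le> 1"
    using dist zero_le_power2[of "norm (x - c)"] zero_le_power2[of t] by linarith+
  then have t: "\<bar>t\<bar> \<le> 1" and "norm (x - c) \<le> 1"
    by (auto simp: abs_square_le_1 power_le_one_iff)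
  then have "\<bar>(x - c) $ i\<bar> \<le> 1" using component_le_norm_cart[of "x - c" i] by linarith
  then have x: "R - 1 \<le> x $ i" by (simp add: c_def)
  have "master_operator s u x t \<le> K"
  proof (rule K[OF t])
    fix y \<tau>
    show "u x t - u y \<tau> \<le> A * ((norm (y - c))\<^sup>2 - (norm (x - c))\<^sup>2 + \<tau>\<^sup>2 - t\<^sup>2)"
      using min[of "(y, \<tau>)"] by (simp add: w_def xt algebra_simps)
  qed
  moreover have "master_operator s u x t = x $ i * u x t powr p"
    using sol by (simp add: classical_solution_def)
  moreover have "0 \<le> R - 1" by (simp add: R_def)
  \<comment> \<open>As \<open>p < 0\<close>, the power is decreasing, so the upper bound
    \<open>M\<close> on \<open>u\<close> becomes a lower bound on
    \<open>u x t powr p\<close>.\<close>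
  then have "(R - 1) * M powr p \<le> x $ i * u x t powr p"
    using x assms(3) pos le by (intro mult_mono powr_mono2') auto
  moreover have "(R - 1) * M powr p = M powr p + \<bar>K\<bar>"
    using M by (simp add: R_def algebra_simps)
  moreover have "0 < M powr p" using M by simp
  ultimately show False by linarith
qed

end
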